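(* There is a unique real number $e > 0$ such that $\ln e = 1$, where $\ln a$ is defined as the derivative at $x=0$ of $x \mapsto a^x$. Moreover, $2 < e < 3$.
   Context: For real $a > 0$, $a^x$ ($x \in \mathbb{R}$) is the continuous extension to $\mathbb{R}$ of the function $q \mapsto a^q$ defined on $\mathbb{Q}$ (rational powers). Equivalently, $a^x = \sup\{a^q : q \in \mathbb{Q},\ q < x\}$ if $a \ge 1$, and $a^x = \inf\{a^q : q \in \mathbb{Q},\ q < x\}$ if $0 < a < 1$. For every real $a>0$ the function $x \mapsto a^x$ is differentiable at $0$, and $\ln : (0,\infty) \to \mathbb{R}$ is defined by $\ln a = \left.\frac{d}{dx} a^x\right|_{x=0}$, i.e. $\ln a = \lim_{h \to 0} \frac{a^h - 1}{h}$. *)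

theory Defs
  imports "HOL-Analysis.Analysis"
begin

text \<open>
  The library's \<^const>\<open>powr\<close> is defined by \<open>x powr a = exp (a * ln x)\<close>, so real powers and the
  logarithm are built here from integer powers and roots, without \<^const>\<open>exp\<close> and \<^const>\<open>ln\<close>.
  Throughout, only bases \<open>a > 0\<close> are meaningful.
\<close>

text \<open>\<open>a\<^sup>q\<close> is the \<open>n\<close>-th root of \<open>a\<^sup>m\<close>, with \<open>q = m / n\<close> in lowest terms and \<open>n > 0\<close>.\<close>
definition rat_power :: "real \<Rightarrow> rat \<Rightarrow> real" where
  "rat_power a q = (case quotient_of q of (m, n) \<Rightarrow> root (nat n) (a powi m))"

definition real_power :: "real \<Rightarrow> real \<Rightarrow> real" where
  "real_power a =
     (THE f. continuous_on UNIV f \<and> (\<forall>q::rat. f (of_rat q) = rat_power a q))"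

definition nat_log :: "real \<Rightarrow> real" where
  "nat_log a = deriv (real_power a) 0"

text \<open>Both definitions by description are meaningful: the continuous extension exists uniquely
  and is differentiable at \<open>0\<close>.\<close>

lemma rat_power_eq_powr:
  assumes "a > 0"
  shows "rat_power a q = a powr of_rat q"
proof -
  obtain m n where mn: "quotient_of q = (m, n)" by (cases "quotient_of q")
  have n: "n > 0" using mn by (rule quotient_of_denom_pos)
  have q: "(of_rat q :: real) = of_int m / of_int n"
    using quotient_of_div[OF mn] by (simp add: of_rat_divide)
  have "root (nat n) (a powi m) = (a powi m) powr (1 / of_int n)"
    using n assms by (simp add: root_powr_inverse)
  also have "\<dots> = (a powr of_int m) powr (1 / of_int n)"
    using assms by (simp add: powr_real_of_int')
  also have "\<dots> = a powr of_rat q"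
    by (simp add: powr_powr q)
  finally show ?thesis by (simp add: rat_power_def mn)
qed

lemma ex1_continuous_extension:
  assumes "a > 0"
  shows "\<exists>!f. continuous_on UNIV f \<and> (\<forall>q::rat. f (of_rat q :: real) = rat_power a q)"
proof (rule ex1I[of _ "\<lambda>x. a powr x"])
  show "continuous_on UNIV (\<lambda>x. a powr x) \<and> (\<forall>q. a powr of_rat q = rat_power a q)"
    using assms by (auto simp: rat_power_eq_powr intro!: continuous_intros)
next
  fix f :: "real \<Rightarrow> real"
  assume f: "continuous_on UNIV f \<and> (\<forall>q. f (of_rat q) = rat_power a q)"
  have cl: "closed {x. f x = a powr x}"
    using f assms by (intro closed_Collect_eq continuous_intros) auto
  have "\<rat> \<subseteq> {x. f x = a powr x}"
    using f assms by (auto simp: Rats_def rat_power_eq_powr)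
  then have "closure \<rat> \<subseteq> {x. f x = a powr x}"
    using cl by (rule closure_minimal)
  moreover have "closure \<rat> = (UNIV :: real set)"
  proof (intro equalityI subsetI UNIV_I)
    fix x :: real
    have "\<exists>y\<in>\<rat>. dist y x < e" if "e > 0" for e
      using Rats_dense_in_real[of x "x + e"] that by (force simp: dist_real_def)
    then show "x \<in> closure \<rat>" by (simp add: closure_approachable)
  qed
  ultimately show "f = (\<lambda>x. a powr x)" by auto
qed

lemma real_power_continuous_extension:
  assumes "a > 0"
  shows "continuous_on UNIV (real_power a)" "real_power a (of_rat q) = rat_power a q"
  using theI'[OF ex1_continuous_extension[OF assms]] unfolding real_power_def by auto

lemma real_power_eq_powr:
  assumes "a > 0"
  shows "real_power a x = a powr x"
proof -
  have "continuous_on UNIV (\<lambda>x. a powr x) \<and> (\<forall>q. a powr of_rat q = rat_power a q)"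
    using assms by (auto simp: rat_power_eq_powr intro!: continuous_intros)
  then have "real_power a = (\<lambda>x. a powr x)"
    unfolding real_power_def by (rule the1_equality[OF ex1_continuous_extension[OF assms]])
  then show ?thesis by simp
qed

lemma real_power_differentiable:
  assumes "a > 0"
  shows "real_power a field_differentiable (at 0)"
proof -
  have "real_power a = (\<lambda>x. exp (x * ln a))"
    using assms by (auto simp: real_power_eq_powr powr_def)
  moreover have "((\<lambda>x. exp (x * ln a)) has_field_derivative ln a) (at 0)"
    by (auto intro!: derivative_eq_intros)
  ultimately show ?thesis by (auto simp: field_differentiable_def)
qed

end

theory Submission
  imports Defs
begin

text \<open>For a > 0 the power a^x is exp (x * ln a), whose derivative at 0 is ln a. So
  \<open>nat_log\<close> agrees with the library's \<open>ln\<close> on positive reals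
  (\<open>nat_log_eq_ln\<close>), and the only solution is \<open>exp 1\<close>, as
  \<open>exp\<close> and \<open>ln\<close> are mutually inverse. Both bounds on \<open>exp 1\<close>
  come from 1 + x \<le> exp x at a small x, raised to a power.\<close>

lemma nat_log_eq_ln:
  assumes "a > 0"
  shows "nat_log a = ln a"
proof -
  have "real_power a = (\<lambda>x. exp (x * ln a))"
    using assms by (auto simp: real_power_eq_powr powr_def)
  moreover have "((\<lambda>x. exp (x * ln a)) has_field_derivative ln a) (at 0)"
    by (auto intro!: derivative_eq_intros)
  ultimately show ?thesis
    by (simp add: nat_log_def DERIV_imp_deriv)
qed

lemma two_less_exp_1: "2 < exp (1::real)"
proof -
  \<comment> \<open>The tangent bound at x = 1 gives only 2 \<le> exp 1; squaring it at x = 1/2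
    gives 9/4, hence strictness.\<close>
  have "(3 / 2) ^ 2 \<le> exp (1 / 2 :: real) ^ 2"
    using exp_ge_add_one_self[of "1 / 2 :: real"] by (intro power_mono) auto
  also have "\<dots> = exp 1"
    by (simp flip: exp_of_nat_mult)
  finally show ?thesis
    by (simp add: power2_eq_square)
qed

text \<open>A negative x turns the lower bound 1 + x \<le> exp x into an upper bound on exp 1,
  through its inverse.\<close>

lemma exp_1_less_three: "exp (1::real) < 3"
proof -
  \<comment> \<open>6 is the least n with (1 - 1/n)^n > 1/3: (5/6)^6 is about 0.335, while (4/5)^5
    is about 0.328.\<close>
  have "(5 / 6) ^ 6 \<le> exp (- 1 / 6 :: real) ^ 6"
    using exp_ge_add_one_self[of "- 1 / 6 :: real"] by (intro power_mono) auto
  also have "\<dots> = inverse (exp 1)"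
    by (simp flip: exp_of_nat_mult exp_minus)
  finally have "exp 1 * (5 / 6) ^ 6 \<le> (1::real)"
    by (simp add: field_simps)
  then show ?thesis
    by (simp add: eval_nat_numeral)
qed

theorem theorem3p11:
  shows "(\<exists>!e::real. e > 0 \<and> nat_log e = 1)
       \<and> (\<forall>e::real. e > 0 \<and> nat_log e = 1 \<longrightarrow> 2 < e \<and> e < 3)"
proof -
  have "e > 0 \<and> nat_log e = 1 \<longleftrightarrow> e = exp 1" for e :: real
    by (metis exp_gt_zero exp_ln ln_exp nat_log_eq_ln)
  then show ?thesis
    using two_less_exp_1 exp_1_less_three by simp
qed

end
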